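(* Let $1\rightarrow N\rightarrow G\xrightarrow{\pi} K\rightarrow 1$ be an extension (short exact sequence) of finite groups such that the induced outer action of $K$ on $N$ is trivial. If $N$ is nilpotent, $K$ is centerless, and $G$ is stable, then $G\cong N\times K$ and $K$ is complete.
   Context: All groups are finite. A group $G$ is stable if $G\cong \operatorname{Aut}(G)$ (abstractly isomorphic). A group $K$ is centerless if $Z(K)$ is trivial. A group $K$ is complete if the conjugation map $c:K\rightarrow \operatorname{Aut}(K)$, $c(g)=c_g$ with $c_g(x)=gxg^{-1}$, is an isomorphism. Identifying $N$ with its image in $G$, the induced outer action is the homomorphism $K\cong G/N\to \operatorname{Out}(N)=\operatorname{Aut}(N)/\operatorname{Inn}(N)$ given by conjugation in $G$; it is trivial if for every $g\in G$ the automorphism $x\mapsto gxg^{-1}$ of $N$ is an inner automorphism of $N$. *)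

theory Defs
  imports "HOL-Algebra.Algebra"
begin

definition center :: "('a, 'm) monoid_scheme \<Rightarrow> 'a set" where
  "center G = {z \<in> carrier G. \<forall>x \<in> carrier G. z \<otimes>\<^bsub>G\<^esub> x = x \<otimes>\<^bsub>G\<^esub> z}"

definition centerless :: "('a, 'm) monoid_scheme \<Rightarrow> bool" where
  "centerless G \<longleftrightarrow> center G = {\<one>\<^bsub>G\<^esub>}"

fun lower_central :: "('a, 'm) monoid_scheme \<Rightarrow> nat \<Rightarrow> 'a set" where
  "lower_central G 0 = carrier G"
| "lower_central G (Suc n) = generate G
     {x \<otimes>\<^bsub>G\<^esub> y \<otimes>\<^bsub>G\<^esub> inv\<^bsub>G\<^esub> x \<otimes>\<^bsub>G\<^esub> inv\<^bsub>G\<^esub> y | x y. x \<in> lower_central G n \<and> y \<in> carrier G}"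

definition nilpotent_group :: "('a, 'm) monoid_scheme \<Rightarrow> bool" where
  "nilpotent_group G \<longleftrightarrow> (\<exists>n. lower_central G n = {\<one>\<^bsub>G\<^esub>})"

definition stable_group :: "('a, 'm) monoid_scheme \<Rightarrow> bool" where
  "stable_group G \<longleftrightarrow> G \<cong> AutoGroup G"

text \<open>Restricted to the carrier, since the elements of \<^const>\<open>AutoGroup\<close> are extensional functions.\<close>

definition conj_aut :: "('a, 'm) monoid_scheme \<Rightarrow> 'a \<Rightarrow> 'a \<Rightarrow> 'a" where
  "conj_aut G g = (\<lambda>x \<in> carrier G. g \<otimes>\<^bsub>G\<^esub> x \<otimes>\<^bsub>G\<^esub> inv\<^bsub>G\<^esub> g)"

definition Inn :: "('a, 'm) monoid_scheme \<Rightarrow> ('a \<Rightarrow> 'a) set" where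
  "Inn G = conj_aut G ` carrier G"

definition complete_group :: "('a, 'm) monoid_scheme \<Rightarrow> bool" where
  "complete_group G \<longleftrightarrow> conj_aut G \<in> iso G (AutoGroup G)"

text \<open>The predicate \<open>short_exact_sequence\<close> of the library forces the three groups to have
  the same element type; this is the form given by \<open>short_exact_sequence_iff\<close>, without that
  restriction.\<close>

definition group_extension ::
  "('n, 'x) monoid_scheme \<Rightarrow> ('g, 'y) monoid_scheme \<Rightarrow> ('k, 'z) monoid_scheme
     \<Rightarrow> ('n \<Rightarrow> 'g) \<Rightarrow> ('g \<Rightarrow> 'k) \<Rightarrow> bool" where
  "group_extension N G K \<iota> \<pi> \<longleftrightarrow>
     group N \<and> group G \<and> group K \<and>
     \<iota> \<in> mon N G \<and> \<pi> \<in> epi G K \<and> kernel G K \<pi> = \<iota> ` carrier N"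

text \<open>Conjugation by \<open>g \<in> G\<close> on \<open>N\<close>, transported along the identification of \<open>N\<close> with
  \<open>\<iota> ` carrier N\<close>; it is a well-defined automorphism because the image of \<open>\<iota>\<close> is normal
  (see \<open>conj_on_kernel_auto\<close> below).\<close>

definition conj_on_kernel ::
  "('n, 'x) monoid_scheme \<Rightarrow> ('g, 'y) monoid_scheme \<Rightarrow> ('n \<Rightarrow> 'g) \<Rightarrow> 'g \<Rightarrow> 'n \<Rightarrow> 'n" where
  "conj_on_kernel N G \<iota> g =
     (\<lambda>x \<in> carrier N. inv_into (carrier N) \<iota> (g \<otimes>\<^bsub>G\<^esub> \<iota> x \<otimes>\<^bsub>G\<^esub> inv\<^bsub>G\<^esub> g))"

text \<open>The outer action sends \<open>\<pi> g\<close> to the class of \<^term>\<open>conj_on_kernel N G \<iota> g\<close> modulo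
  \<^term>\<open>Inn N\<close>, and every element of the quotient is of the form \<open>\<pi> g\<close>.\<close>

definition trivial_outer_action ::
  "('n, 'x) monoid_scheme \<Rightarrow> ('g, 'y) monoid_scheme \<Rightarrow> ('n \<Rightarrow> 'g) \<Rightarrow> bool" where
  "trivial_outer_action N G \<iota> \<longleftrightarrow> (\<forall>g \<in> carrier G. conj_on_kernel N G \<iota> g \<in> Inn N)"

lemma conj_on_kernel_image:
  assumes "group_extension N G K \<iota> \<pi>" and g: "g \<in> carrier G" and x: "x \<in> carrier N"
  shows "conj_on_kernel N G \<iota> g x \<in> carrier N"
    and "\<iota> (conj_on_kernel N G \<iota> g x) = g \<otimes>\<^bsub>G\<^esub> \<iota> x \<otimes>\<^bsub>G\<^esub> inv\<^bsub>G\<^esub> g"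
proof -
  interpret p: group_hom G K \<pi>
    using assms(1)
    by (auto simp: group_extension_def epi_def group_hom_def group_hom_axioms_def)
  have ker: "kernel G K \<pi> = \<iota> ` carrier N"
    using assms(1) by (simp add: group_extension_def)
  have "\<iota> x \<in> kernel G K \<pi>"
    using ker x by simp
  then have "g \<otimes>\<^bsub>G\<^esub> \<iota> x \<otimes>\<^bsub>G\<^esub> inv\<^bsub>G\<^esub> g \<in> \<iota> ` carrier N"
    using p.normal_kernel g unfolding ker[symmetric] by (simp add: normal.inv_op_closed2)
  then show "conj_on_kernel N G \<iota> g x \<in> carrier N"
    and "\<iota> (conj_on_kernel N G \<iota> g x) = g \<otimes>\<^bsub>G\<^esub> \<iota> x \<otimes>\<^bsub>G\<^esub> inv\<^bsub>G\<^esub> g"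
    using x by (auto simp: conj_on_kernel_def inv_into_into f_inv_into_f)
qed

lemma conj_on_kernel_auto:
  assumes ext: "group_extension N G K \<iota> \<pi>" and g: "g \<in> carrier G"
  shows "conj_on_kernel N G \<iota> g \<in> auto N"
proof -
  interpret N: group N using ext by (simp add: group_extension_def)
  interpret G: group G using ext by (simp add: group_extension_def)
  interpret i: group_hom N G \<iota>
    using ext by (auto simp: group_extension_def mon_def group_hom_def group_hom_axioms_def)
  have inj: "inj_on \<iota> (carrier N)"
    using ext by (simp add: group_extension_def mon_def)
  let ?c = "conj_on_kernel N G \<iota>"
  note cc = conj_on_kernel_image(1)[OF ext] and ci = conj_on_kernel_image(2)[OF ext]
  have cancel: "h \<otimes>\<^bsub>G\<^esub> (inv\<^bsub>G\<^esub> h \<otimes>\<^bsub>G\<^esub> y \<otimes>\<^bsub>G\<^esub> h) \<otimes>\<^bsub>G\<^esub> inv\<^bsub>G\<^esub> h = y"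
    if "h \<in> carrier G" "y \<in> carrier G" for h y
  proof -
    have "h \<otimes>\<^bsub>G\<^esub> (inv\<^bsub>G\<^esub> h \<otimes>\<^bsub>G\<^esub> y) = y"
      using that by (simp flip: G.m_assoc)
    then show ?thesis
      using that by (simp add: G.m_assoc)
  qed
  have "?c g (x \<otimes>\<^bsub>N\<^esub> y) = ?c g x \<otimes>\<^bsub>N\<^esub> ?c g y" if "x \<in> carrier N" "y \<in> carrier N" for x y
  proof (rule inj_onD[OF inj])
    have "inv\<^bsub>G\<^esub> g \<otimes>\<^bsub>G\<^esub> (g \<otimes>\<^bsub>G\<^esub> (\<iota> y \<otimes>\<^bsub>G\<^esub> inv\<^bsub>G\<^esub> g)) = \<iota> y \<otimes>\<^bsub>G\<^esub> inv\<^bsub>G\<^esub> g"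
      using that g by (simp flip: G.m_assoc)
    then show "\<iota> (?c g (x \<otimes>\<^bsub>N\<^esub> y)) = \<iota> (?c g x \<otimes>\<^bsub>N\<^esub> ?c g y)"
      using that g by (simp add: ci cc G.m_assoc)
  qed (use that g cc in auto)
  then have hom: "?c g \<in> hom N N"
    using g cc by (auto simp: hom_def)
  have inverse: "?c h (?c (inv\<^bsub>G\<^esub> h) x) = x" if "h \<in> carrier G" "x \<in> carrier N" for h x
    by (rule inj_onD[OF inj]) (use that in \<open>simp_all add: ci cc cancel\<close>)
  have "bij_betw (?c g) (carrier N) (carrier N)"
  proof (rule bij_betw_byWitness[where f' = "?c (inv\<^bsub>G\<^esub> g)"])
    show "\<forall>x\<in>carrier N. ?c (inv\<^bsub>G\<^esub> g) (?c g x) = x"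
      using inverse[of "inv\<^bsub>G\<^esub> g"] g by simp
  qed (use inverse cc g in auto)
  then show ?thesis
    using hom by (simp add: auto_def Bij_def conj_on_kernel_def)
qed

end

theory Submission
  imports Defs
begin

text \<open>Identify \<open>N\<close> with its image in \<open>G\<close>. Since the outer action is trivial, \<open>G = N C\<close> where
  \<open>C\<close> is the centralizer of \<open>N\<close> in \<open>G\<close>; so \<open>C\<close> maps onto \<open>K\<close>, and \<open>C \<inter> N\<close> is central in \<open>G\<close>.

  Everything rests on \<open>hom_trivial_on_nilpotent_kernel\<close>: a homomorphism from \<open>G\<close> whose image is
  centerless kills \<open>N\<close>. It kills the trivial term of the lower central series of \<open>N\<close>, and if it
  kills one term, then it sends the elements of the preceding term to elements that commute with
  the images of \<open>N\<close> and of \<open>C\<close>, that is, to central elements of the image. This is used three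
  times.

  First, \<open>\<pi> \<circ> \<alpha>\<close> kills \<open>N\<close> for each automorphism \<open>\<alpha>\<close> of \<open>G\<close>. Hence \<open>N\<close> and \<open>C\<close> are
  characteristic, and there is an induced homomorphism \<open>\<rho>\<close> from \<open>Aut G\<close> to \<open>Aut K\<close>. Its image
  contains \<open>Inn K\<close>, which has trivial centralizer in \<open>Aut K\<close>; so the image of \<open>\<rho>\<close> is centerless.

  Secondly, let \<open>\<Phi>\<close> be an isomorphism from \<open>G\<close> to \<open>Aut G\<close>. Then \<open>\<rho> \<circ> \<Phi>\<close> kills \<open>N\<close>, so the
  automorphisms in \<open>\<Phi> N\<close> act trivially on \<open>K\<close>. On the other side, the conjugations by
  elements of \<open>C\<close> form a copy of \<open>K\<close> in \<open>Aut G\<close>, as \<open>C \<inter> N\<close> is central. An automorphism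
  \<open>\<alpha>\<close> that is trivial on \<open>K\<close> moves \<open>c \<in> C\<close> only within its coset of \<open>C \<inter> N\<close>, so it commutes
  with conjugation by \<open>c\<close>; and conjugation by \<open>c\<close> acts on the centerless group \<open>K\<close> trivially only
  if \<open>\<pi> c = 1\<close>. So \<open>N \<times> K\<close> embeds in \<open>Aut G\<close>, and by counting the embedding is onto
  (\<open>kernel_times_section_iso\<close>). Thus \<open>G \<cong> Aut G \<cong> N \<times> K\<close>, and moreover every automorphism of
  \<open>G\<close> induces an inner automorphism of \<open>K\<close>.

  Thirdly, let \<open>p\<close> be the projection of \<open>G \<cong> N \<times> K\<close> onto the second factor. It is some
  surjection, possibly different from \<open>\<pi>\<close>, but it kills \<open>N\<close> too and so factors through \<open>\<pi>\<close>.
  An automorphism \<open>\<sigma>\<close> of \<open>K\<close> extends to \<open>N \<times> K\<close>, hence lifts along \<open>p\<close> to an automorphism of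
  \<open>G\<close>; that one acts on the quotient as a conjugation, so \<open>\<sigma>\<close> is inner
  (\<open>complete_quotient\<close>).\<close>

section \<open>Automorphism groups\<close>

lemma carrier_AutoGroup [simp]: "carrier (AutoGroup G) = auto G"
  by (simp add: AutoGroup_def)

lemma mult_AutoGroup:
  assumes "\<alpha> \<in> auto G" and "\<beta> \<in> auto G"
  shows "\<alpha> \<otimes>\<^bsub>AutoGroup G\<^esub> \<beta> = compose (carrier G) \<alpha> \<beta>"
  using assms by (simp add: AutoGroup_def BijGroup_def auto_def)

lemma one_AutoGroup: "\<one>\<^bsub>AutoGroup G\<^esub> = (\<lambda>x \<in> carrier G. x)"
  by (simp add: AutoGroup_def BijGroup_def)

lemma auto_iff_iso: "\<alpha> \<in> auto G \<longleftrightarrow> \<alpha> \<in> extensional (carrier G) \<and> \<alpha> \<in> iso G G"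
  by (auto simp: auto_def Bij_def iso_def)

lemma auto_hom: "\<alpha> \<in> auto G \<Longrightarrow> \<alpha> \<in> hom G G"
  by (simp add: auto_def)

lemma auto_closed: "\<alpha> \<in> auto G \<Longrightarrow> x \<in> carrier G \<Longrightarrow> \<alpha> x \<in> carrier G"
  using auto_hom hom_in_carrier by fastforce

lemma auto_surj: "\<alpha> \<in> auto G \<Longrightarrow> \<alpha> ` carrier G = carrier G"
  by (simp add: auto_def Bij_def bij_betw_def)

lemma auto_eqI:
  assumes "\<alpha> \<in> auto G" and "\<beta> \<in> auto G" and "\<And>x. x \<in> carrier G \<Longrightarrow> \<alpha> x = \<beta> x"
  shows "\<alpha> = \<beta>"
  using assms by (auto simp: auto_iff_iso intro: extensionalityI)

lemma restrict_iso_auto: "f \<in> iso G G \<Longrightarrow> group G \<Longrightarrow> restrict f (carrier G) \<in> auto G"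
  by (auto simp: auto_def Bij_def iso_def hom_def bij_betw_def inj_on_def group_def monoid.m_closed)

context group
begin

lemma conj_aut_mult:
  assumes "g \<in> carrier G" and "h \<in> carrier G" and "x \<in> carrier G"
  shows "conj_aut G (g \<otimes> h) x = conj_aut G g (conj_aut G h x)"
  using assms by (simp add: conj_aut_def inv_mult_group m_assoc)

lemma conj_aut_hom_self:
  assumes "g \<in> carrier G"
  shows "conj_aut G g \<in> hom G G"
proof (rule homI)
  fix x y assume xy: "x \<in> carrier G" "y \<in> carrier G"
  have "inv g \<otimes> (g \<otimes> (y \<otimes> inv g)) = y \<otimes> inv g"
    using assms xy by (simp flip: m_assoc)
  then show "conj_aut G g (x \<otimes> y) = conj_aut G g x \<otimes> conj_aut G g y"
    using assms xy by (simp add: conj_aut_def m_assoc)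
qed (use assms in \<open>simp add: conj_aut_def\<close>)

lemma conj_aut_auto:
  assumes "g \<in> carrier G"
  shows "conj_aut G g \<in> auto G"
proof -
  have inverse: "conj_aut G h (conj_aut G (inv h) x) = x" if "h \<in> carrier G" "x \<in> carrier G" for h x
    using that conj_aut_mult[of h "inv h" x] by (simp add: conj_aut_def)
  have closed: "conj_aut G h x \<in> carrier G" if "h \<in> carrier G" "x \<in> carrier G" for h x
    using that by (simp add: conj_aut_def)
  have "bij_betw (conj_aut G g) (carrier G) (carrier G)"
  proof (rule bij_betw_byWitness[where f' = "conj_aut G (inv g)"])
    show "\<forall>x\<in>carrier G. conj_aut G (inv g) (conj_aut G g x) = x"
      using inverse[of "inv g"] assms by simp
  qed (use inverse closed assms in auto)
  then show ?thesis
    using conj_aut_hom_self[OF assms] by (simp add: auto_def Bij_def conj_aut_def)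
qed

lemma conj_aut_hom: "conj_aut G \<in> hom G (AutoGroup G)"
proof (rule homI)
  fix g h assume gh: "g \<in> carrier G" "h \<in> carrier G"
  have "compose (carrier G) (conj_aut G g) (conj_aut G h) = conj_aut G (g \<otimes> h)"
    using gh conj_aut_mult by (auto simp: compose_def conj_aut_def)
  then show "conj_aut G (g \<otimes> h) = conj_aut G g \<otimes>\<^bsub>AutoGroup G\<^esub> conj_aut G h"
    using gh by (simp add: mult_AutoGroup conj_aut_auto)
qed (simp add: conj_aut_auto)

lemma commute_iff_conj_fixed:
  assumes "g \<in> carrier G" and "x \<in> carrier G"
  shows "g \<otimes> x = x \<otimes> g \<longleftrightarrow> g \<otimes> x \<otimes> inv g = x"
  using assms by (metis inv_solve_right m_closed)

lemma hom_conj: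
  assumes "\<alpha> \<in> hom G H" and "group H" and "g \<in> carrier G" and "x \<in> carrier G"
  shows "\<alpha> (g \<otimes> x \<otimes> inv g) = \<alpha> g \<otimes>\<^bsub>H\<^esub> \<alpha> x \<otimes>\<^bsub>H\<^esub> inv\<^bsub>H\<^esub> \<alpha> g"
proof -
  interpret a: group_hom G H \<alpha>
    using assms by (simp add: group_hom_def group_hom_axioms_def is_group)
  show ?thesis using assms by simp
qed

lemma auto_conj_aut:
  assumes "\<alpha> \<in> auto G" and "g \<in> carrier G" and "x \<in> carrier G"
  shows "\<alpha> (conj_aut G g x) = conj_aut G (\<alpha> g) (\<alpha> x)"
  using assms hom_conj[OF auto_hom[OF assms(1)]] auto_closed[OF assms(1)]
  by (simp add: conj_aut_def is_group)

lemma centerless_conj_fixed: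
  assumes "centerless G" and "g \<in> carrier G" and "\<And>x. x \<in> carrier G \<Longrightarrow> conj_aut G g x = x"
  shows "g = \<one>"
proof -
  have "g \<in> center G"
    using assms by (simp add: center_def conj_aut_def commute_iff_conj_fixed)
  then show ?thesis using assms(1) by (simp add: centerless_def)
qed

lemma conj_aut_inj:
  assumes "centerless G"
  shows "inj_on (conj_aut G) (carrier G)"
proof -
  interpret c: group_hom G "AutoGroup G" "conj_aut G"
    using conj_aut_hom AutoGroup by (simp add: group_hom_def group_hom_axioms_def is_group)
  show ?thesis
    unfolding c.inj_on_one_iff
    using centerless_conj_fixed[OF assms] by (auto simp: one_AutoGroup)
qed

lemma complete_groupI:
  assumes "centerless G" and "auto G \<subseteq> Inn G"
  shows "complete_group G"
proof -
  have "conj_aut G ` carrier G = auto G"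
    using assms(2) conj_aut_auto by (auto simp: Inn_def)
  then show ?thesis
    using conj_aut_hom conj_aut_inj[OF assms(1)]
    by (simp add: complete_group_def iso_def bij_betw_def)
qed

end

section \<open>Automorphisms induced on a quotient\<close>

text \<open>The value does not depend on the preimage chosen by \<^const>\<open>inv_into\<close> as soon as \<open>\<alpha>\<close>
  preserves the kernel of \<open>\<pi>\<close>; see \<open>quotient_aut_apply\<close> below.\<close>

definition quotient_aut ::
  "('g, 'y) monoid_scheme \<Rightarrow> ('k, 'z) monoid_scheme \<Rightarrow> ('g \<Rightarrow> 'k) \<Rightarrow> ('g \<Rightarrow> 'g) \<Rightarrow> 'k \<Rightarrow> 'k" where
  "quotient_aut G K \<pi> \<alpha> = (\<lambda>k \<in> carrier K. \<pi> (\<alpha> (inv_into (carrier G) \<pi> k)))"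

context group_hom
begin

lemma eq_iff_diff_in_kernel:
  assumes "x \<in> carrier G" and "y \<in> carrier G"
  shows "h x = h y \<longleftrightarrow> x \<otimes> inv y \<in> kernel G H h"
  using assms by (simp add: kernel_def H.inv_solve_right')

lemma order_eq_card_kernel_times_order:
  assumes "h ` carrier G = carrier H"
  shows "order G = card (kernel G H h) * order H"
proof -
  have "G Mod kernel G H h \<cong> H"
    by (rule FactGroup_iso[OF assms])
  then have "card (rcosets kernel G H h) = order H"
    using iso_same_card by (fastforce simp: FactGroup_def order_def)
  then show ?thesis
    using G.lagrange[OF subgroup_kernel] by (simp add: mult.commute)
qed

text \<open>Only inclusion is assumed of the automorphisms: applied to the inverse automorphism, it gives
  equality, which is why the induced maps are bijective.\<close>

context
  assumes surj: "h ` carrier G = carrier H"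
    and kernel_char: "\<And>\<alpha> x. \<alpha> \<in> auto G \<Longrightarrow> x \<in> kernel G H h \<Longrightarrow> \<alpha> x \<in> kernel G H h"
begin

lemma quotient_aut_apply:
  assumes "\<alpha> \<in> auto G" and "x \<in> carrier G"
  shows "quotient_aut G H h \<alpha> (h x) = h (\<alpha> x)"
proof -
  interpret a: group_hom G G \<alpha>
    using assms(1) auto_hom by (simp add: group_hom_def group_hom_axioms_def G.is_group)
  define y where "y = inv_into (carrier G) h (h x)"
  have y: "y \<in> carrier G" "h y = h x"
    using assms by (auto simp: y_def inv_into_into f_inv_into_f)
  then have "y \<otimes> inv x \<in> kernel G H h"
    using assms eq_iff_diff_in_kernel by blast
  then have "\<alpha> (y \<otimes> inv x) \<in> kernel G H h"
    using assms kernel_char by blast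
  then have "h (\<alpha> y) = h (\<alpha> x)"
    using eq_iff_diff_in_kernel[of "\<alpha> y" "\<alpha> x"] y assms by simp
  then show ?thesis
    using assms by (simp add: quotient_aut_def y_def)
qed

lemma quotient_aut_hom: "quotient_aut G H h \<in> hom (AutoGroup G) (AutoGroup H)"
proof -
  interpret A: group "AutoGroup G" by (rule G.AutoGroup)
  let ?q = "quotient_aut G H h"
  have lift: "\<exists>x. x \<in> carrier G \<and> k = h x" if "k \<in> carrier H" for k
    using that unfolding surj[symmetric] by blast
  have q_closed: "?q \<alpha> k \<in> carrier H" if "\<alpha> \<in> auto G" "k \<in> carrier H" for \<alpha> k
    using lift[OF that(2)] that(1) auto_closed[OF that(1)] quotient_aut_apply[OF that(1)] by (metis hom_closed)
  have q_mult: "?q (\<alpha> \<otimes>\<^bsub>AutoGroup G\<^esub> \<beta>) k = ?q \<alpha> (?q \<beta> k)"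
    if ab: "\<alpha> \<in> auto G" "\<beta> \<in> auto G" and k: "k \<in> carrier H" for \<alpha> \<beta> k
  proof -
    obtain x where x: "x \<in> carrier G" "k = h x" using k lift by blast
    have "\<alpha> \<otimes>\<^bsub>AutoGroup G\<^esub> \<beta> \<in> auto G"
      using ab A.m_closed by simp
    then have "?q (\<alpha> \<otimes>\<^bsub>AutoGroup G\<^esub> \<beta>) k = h ((\<alpha> \<otimes>\<^bsub>AutoGroup G\<^esub> \<beta>) x)"
      unfolding x(2) by (rule quotient_aut_apply[OF _ x(1)])
    also have "\<dots> = h (\<alpha> (\<beta> x))"
      using ab x(1) by (simp add: mult_AutoGroup compose_def)
    also have "\<dots> = ?q \<alpha> (?q \<beta> k)"
      using ab x(1) by (simp only: x(2) quotient_aut_apply auto_closed)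
    finally show ?thesis .
  qed
  have q_one: "?q \<one>\<^bsub>AutoGroup G\<^esub> k = k" if k: "k \<in> carrier H" for k
  proof -
    obtain x where x: "x \<in> carrier G" "k = h x" using k lift by blast
    have "\<one>\<^bsub>AutoGroup G\<^esub> \<in> auto G" using A.one_closed by simp
    then have "?q \<one>\<^bsub>AutoGroup G\<^esub> k = h (\<one>\<^bsub>AutoGroup G\<^esub> x)"
      unfolding x(2) by (rule quotient_aut_apply[OF _ x(1)])
    then show ?thesis using x by (simp add: one_AutoGroup)
  qed
  have q_auto: "?q \<alpha> \<in> auto H" if \<alpha>: "\<alpha> \<in> auto G" for \<alpha>
  proof -
    let ?\<beta> = "inv\<^bsub>AutoGroup G\<^esub> \<alpha>"
    have \<beta>: "?\<beta> \<in> auto G" using \<alpha> A.inv_closed by simp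
    have "bij_betw (?q \<alpha>) (carrier H) (carrier H)"
    proof (rule bij_betw_byWitness[where f' = "?q ?\<beta>"])
      show "\<forall>k\<in>carrier H. ?q ?\<beta> (?q \<alpha> k) = k" "\<forall>k\<in>carrier H. ?q \<alpha> (?q ?\<beta> k) = k"
        using \<alpha> \<beta> q_one by (simp_all flip: q_mult)
    qed (use \<alpha> \<beta> q_closed in auto)
    moreover have "?q \<alpha> \<in> hom H H"
    proof (rule homI)
      fix k l assume k: "k \<in> carrier H" and l: "l \<in> carrier H"
      obtain x where x: "x \<in> carrier G" "k = h x" using lift[OF k] by blast
      obtain y where y: "y \<in> carrier G" "l = h y" using lift[OF l] by blast
      have "?q \<alpha> (k \<otimes>\<^bsub>H\<^esub> l) = ?q \<alpha> (h (x \<otimes> y))"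
        using x y by simp
      also have "\<dots> = h (\<alpha> (x \<otimes> y))"
        by (rule quotient_aut_apply[OF \<alpha>]) (use x y in simp)
      also have "\<dots> = h (\<alpha> x) \<otimes>\<^bsub>H\<^esub> h (\<alpha> y)"
        using x(1) y(1) \<alpha> by (simp add: Group.hom_mult[OF auto_hom[OF \<alpha>]] auto_closed)
      also have "\<dots> = ?q \<alpha> k \<otimes>\<^bsub>H\<^esub> ?q \<alpha> l"
        by (simp only: x y quotient_aut_apply[OF \<alpha>])
      finally show "?q \<alpha> (k \<otimes>\<^bsub>H\<^esub> l) = ?q \<alpha> k \<otimes>\<^bsub>H\<^esub> ?q \<alpha> l" .
    qed (use \<alpha> q_closed in auto)
    ultimately show ?thesis
      by (simp add: auto_def Bij_def quotient_aut_def)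
  qed
  show ?thesis
  proof (rule homI)
    fix \<alpha> \<beta> assume "\<alpha> \<in> carrier (AutoGroup G)" "\<beta> \<in> carrier (AutoGroup G)"
    then have ab: "\<alpha> \<in> auto G" "\<beta> \<in> auto G" by simp_all
    then have "\<alpha> \<otimes>\<^bsub>AutoGroup G\<^esub> \<beta> \<in> auto G"
      using A.m_closed by simp
    then have "?q (\<alpha> \<otimes>\<^bsub>AutoGroup G\<^esub> \<beta>) \<in> extensional (carrier H)"
      using q_auto auto_iff_iso by blast
    then have "?q (\<alpha> \<otimes>\<^bsub>AutoGroup G\<^esub> \<beta>) = compose (carrier H) (?q \<alpha>) (?q \<beta>)"
      by (rule extensionalityI) (use ab q_mult in \<open>auto simp: compose_def\<close>)
    then show "?q (\<alpha> \<otimes>\<^bsub>AutoGroup G\<^esub> \<beta>) = ?q \<alpha> \<otimes>\<^bsub>AutoGroup H\<^esub> ?q \<beta>"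
      using ab q_auto by (simp add: mult_AutoGroup)
  qed (use q_auto in simp)
qed

end

end

section \<open>Internal direct products\<close>

text \<open>Commuting homomorphisms combine to a homomorphism on the direct product; once it is injective,
  the orders force it to be onto.\<close>

lemma commuting_homs_DirProd_iso:
  assumes "group A" and "group B" and "group P"
    and f: "f \<in> hom A P" and g: "g \<in> hom B P"
    and comm: "\<And>a b. a \<in> carrier A \<Longrightarrow> b \<in> carrier B \<Longrightarrow> f a \<otimes>\<^bsub>P\<^esub> g b = g b \<otimes>\<^bsub>P\<^esub> f a"
    and triv: "\<And>a b. a \<in> carrier A \<Longrightarrow> b \<in> carrier B \<Longrightarrow> f a \<otimes>\<^bsub>P\<^esub> g b = \<one>\<^bsub>P\<^esub> \<Longrightarrow>
      a = \<one>\<^bsub>A\<^esub> \<and> b = \<one>\<^bsub>B\<^esub>"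
    and fin: "finite (carrier P)" and ord: "order P = order A * order B"
  shows "(\<lambda>(a, b). f a \<otimes>\<^bsub>P\<^esub> g b) \<in> iso (A \<times>\<times> B) P"
proof -
  interpret P: group P by fact
  let ?m = "\<lambda>(a, b). f a \<otimes>\<^bsub>P\<^esub> g b"
  have fc: "f a \<in> carrier P" if "a \<in> carrier A" for a using f that hom_in_carrier by fastforce
  have gc: "g b \<in> carrier P" if "b \<in> carrier B" for b using g that hom_in_carrier by fastforce
  have hom: "?m \<in> hom (A \<times>\<times> B) P"
  proof (rule homI)
    fix x y assume "x \<in> carrier (A \<times>\<times> B)" "y \<in> carrier (A \<times>\<times> B)"
    then obtain a b c d where xy: "x = (a, b)" "y = (c, d)" "a \<in> carrier A" "b \<in> carrier B"
      "c \<in> carrier A" "d \<in> carrier B" by auto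
    have "f c \<otimes>\<^bsub>P\<^esub> (g b \<otimes>\<^bsub>P\<^esub> g d) = g b \<otimes>\<^bsub>P\<^esub> (f c \<otimes>\<^bsub>P\<^esub> g d)"
      using xy fc gc comm[of c b] by (simp flip: P.m_assoc)
    then show "?m (x \<otimes>\<^bsub>A \<times>\<times> B\<^esub> y) = ?m x \<otimes>\<^bsub>P\<^esub> ?m y"
      using xy fc gc Group.hom_mult[OF f] Group.hom_mult[OF g] by (simp add: P.m_assoc)
  qed (use fc gc in auto)
  interpret m: group_hom "A \<times>\<times> B" P ?m
    using hom assms by (simp add: group_hom_def group_hom_axioms_def DirProd_group)
  have inj: "inj_on ?m (carrier (A \<times>\<times> B))"
    unfolding m.inj_on_one_iff using triv by auto
  then have "card (?m ` carrier (A \<times>\<times> B)) = card (carrier P)"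
    using ord by (simp add: card_image order_def card_cartesian_product)
  then have "?m ` carrier (A \<times>\<times> B) = carrier P"
    using fin hom_carrier[OF hom] by (intro card_subset_eq) auto
  then show ?thesis
    using hom inj by (simp add: iso_def bij_betw_def)
qed

section \<open>Extensions with trivial outer action\<close>

locale inner_extension =
  fixes N :: "('n, 'x) monoid_scheme" and G :: "('g, 'y) monoid_scheme"
    and K :: "('k, 'z) monoid_scheme" and \<iota> :: "'n \<Rightarrow> 'g" and \<pi> :: "'g \<Rightarrow> 'k"
  assumes extension: "group_extension N G K \<iota> \<pi>"
    and outer_trivial: "trivial_outer_action N G \<iota>"
begin

sublocale N: group N using extension by (simp add: group_extension_def)
sublocale G: group G using extension by (simp add: group_extension_def)
sublocale K: group K using extension by (simp add: group_extension_def)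

sublocale \<iota>: group_hom N G \<iota>
  using extension N.is_group G.is_group
  by (auto simp: group_extension_def group_hom_def group_hom_axioms_def mon_def)

sublocale \<pi>: group_hom G K \<pi>
  using extension G.is_group K.is_group
  by (auto simp: group_extension_def group_hom_def group_hom_axioms_def epi_def)

lemma inj: "inj_on \<iota> (carrier N)"
  using extension by (simp add: group_extension_def mon_def)

lemma surj: "\<pi> ` carrier G = carrier K"
  using extension by (simp add: group_extension_def epi_def)

lemma kernel_eq: "kernel G K \<pi> = \<iota> ` carrier N"
  using extension by (simp add: group_extension_def)

lemma \<pi>_\<iota> [simp]: "n \<in> carrier N \<Longrightarrow> \<pi> (\<iota> n) = \<one>\<^bsub>K\<^esub>"
  using kernel_eq by (auto simp: kernel_def)

definition centralizer :: "'g set" where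
  "centralizer = {c \<in> carrier G. \<forall>n \<in> carrier N. c \<otimes>\<^bsub>G\<^esub> \<iota> n = \<iota> n \<otimes>\<^bsub>G\<^esub> c}"

lemma centralizer_closed: "c \<in> centralizer \<Longrightarrow> c \<in> carrier G"
  by (simp add: centralizer_def)

lemma centralizer_commute:
  "c \<in> centralizer \<Longrightarrow> n \<in> carrier N \<Longrightarrow> c \<otimes>\<^bsub>G\<^esub> \<iota> n = \<iota> n \<otimes>\<^bsub>G\<^esub> c"
  by (simp add: centralizer_def)

lemma centralizer_subgroup: "subgroup centralizer G"
proof (rule G.subgroupI)
  show "centralizer \<noteq> {}"
    by (auto simp: centralizer_def intro!: exI[of _ "\<one>\<^bsub>G\<^esub>"])
next
  fix c assume "c \<in> centralizer"
  then show "inv\<^bsub>G\<^esub> c \<in> centralizer"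
    by (simp add: centralizer_def) (metis G.inv_closed G.inv_solve_left G.inv_solve_right G.m_assoc G.m_closed \<iota>.hom_closed)
next
  fix c d assume "c \<in> centralizer" "d \<in> centralizer"
  then show "c \<otimes>\<^bsub>G\<^esub> d \<in> centralizer"
    by (simp add: centralizer_def) (metis G.m_assoc \<iota>.hom_closed)
qed (auto simp: centralizer_def)

text \<open>If \<open>g\<close> acts on \<open>N\<close> as conjugation by \<open>n\<close> does, then \<open>n\<inverse> g\<close> centralizes \<open>N\<close>.\<close>

lemma decompose:
  assumes g: "g \<in> carrier G"
  obtains n c where "n \<in> carrier N" "c \<in> centralizer" "g = \<iota> n \<otimes>\<^bsub>G\<^esub> c"
proof -
  obtain n where n: "n \<in> carrier N" and conj: "conj_on_kernel N G \<iota> g = conj_aut N n"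
    using outer_trivial g by (auto simp: trivial_outer_action_def Inn_def)
  define c where "c = inv\<^bsub>G\<^esub> \<iota> n \<otimes>\<^bsub>G\<^esub> g"
  have c: "c \<in> carrier G" and gc: "g = \<iota> n \<otimes>\<^bsub>G\<^esub> c"
    using g n by (simp_all add: c_def flip: G.m_assoc)
  have "c \<otimes>\<^bsub>G\<^esub> \<iota> x = \<iota> x \<otimes>\<^bsub>G\<^esub> c" if x: "x \<in> carrier N" for x
  proof -
    have "g \<otimes>\<^bsub>G\<^esub> \<iota> x \<otimes>\<^bsub>G\<^esub> inv\<^bsub>G\<^esub> g = \<iota> (conj_aut N n x)"
      using conj_on_kernel_image(2)[OF extension g x] conj by simp
    also have "\<dots> = \<iota> n \<otimes>\<^bsub>G\<^esub> \<iota> x \<otimes>\<^bsub>G\<^esub> inv\<^bsub>G\<^esub> \<iota> n"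
      using n x by (simp add: conj_aut_def)
    finally have "g \<otimes>\<^bsub>G\<^esub> \<iota> x = \<iota> n \<otimes>\<^bsub>G\<^esub> \<iota> x \<otimes>\<^bsub>G\<^esub> inv\<^bsub>G\<^esub> \<iota> n \<otimes>\<^bsub>G\<^esub> g"
      using g n x by (metis G.inv_solve_right G.m_closed G.inv_closed \<iota>.hom_closed)
    also have "\<dots> = \<iota> n \<otimes>\<^bsub>G\<^esub> (\<iota> x \<otimes>\<^bsub>G\<^esub> c)"
      using g n x by (simp add: c_def G.m_assoc)
    also have "g \<otimes>\<^bsub>G\<^esub> \<iota> x = \<iota> n \<otimes>\<^bsub>G\<^esub> (c \<otimes>\<^bsub>G\<^esub> \<iota> x)"
      using n x c by (simp add: gc G.m_assoc)
    finally have "\<iota> n \<otimes>\<^bsub>G\<^esub> (c \<otimes>\<^bsub>G\<^esub> \<iota> x) = \<iota> n \<otimes>\<^bsub>G\<^esub> (\<iota> x \<otimes>\<^bsub>G\<^esub> c)" .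
    then show ?thesis
      using n x c by (simp add: G.l_cancel)
  qed
  then show ?thesis
    using c by (intro that[OF n _ gc]) (simp add: centralizer_def)
qed

lemma \<pi>_centralizer: "\<pi> ` centralizer = carrier K"
proof
  show "carrier K \<subseteq> \<pi> ` centralizer"
  proof
    fix k assume "k \<in> carrier K"
    then obtain g where g: "g \<in> carrier G" "k = \<pi> g" using surj by auto
    obtain n c where nc: "n \<in> carrier N" "c \<in> centralizer" "g = \<iota> n \<otimes>\<^bsub>G\<^esub> c"
      using decompose[OF g(1)] .
    then have "k = \<pi> c" using g by (simp add: centralizer_closed)
    then show "k \<in> \<pi> ` centralizer" using nc by blast
  qed
qed (auto simp: centralizer_def)

text \<open>Two elements of the centralizer \<open>C\<close> of \<open>N\<close> over the same point of \<open>K\<close> differ by an element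
  of \<open>C \<inter> N\<close>. It commutes with \<open>N\<close>, being in \<open>C\<close>, and with \<open>C\<close>, being in \<open>N\<close>, so it is central
  in \<open>G = N C\<close> and conjugation cannot see it. This makes conjugation by elements of \<open>C\<close> an
  action of \<open>K\<close>, even where \<open>C\<close> itself does not split over \<open>C \<inter> N\<close>.\<close>

lemma conj_aut_centralizer_cong:
  assumes c: "c \<in> centralizer" and d: "d \<in> centralizer" and eq: "\<pi> c = \<pi> d"
  shows "conj_aut G c = conj_aut G d"
proof -
  note cG = centralizer_closed[OF c] and dG = centralizer_closed[OF d]
  define z where "z = c \<otimes>\<^bsub>G\<^esub> inv\<^bsub>G\<^esub> d"
  have zC: "z \<in> centralizer"
    using centralizer_subgroup c d by (simp add: z_def subgroup.m_closed subgroup.m_inv_closed)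
  have "z \<in> kernel G K \<pi>"
    using eq cG dG \<pi>.eq_iff_diff_in_kernel z_def by blast
  then obtain m where m: "m \<in> carrier N" "z = \<iota> m" using kernel_eq by auto
  have zG: "z \<in> carrier G" using zC centralizer_closed by blast
  have central: "z \<otimes>\<^bsub>G\<^esub> x = x \<otimes>\<^bsub>G\<^esub> z" if x: "x \<in> carrier G" for x
  proof -
    obtain n e where ne: "n \<in> carrier N" "e \<in> centralizer" "x = \<iota> n \<otimes>\<^bsub>G\<^esub> e"
      using decompose[OF x] .
    have "z \<otimes>\<^bsub>G\<^esub> \<iota> n = \<iota> n \<otimes>\<^bsub>G\<^esub> z" using centralizer_commute zC ne by blast
    moreover have "z \<otimes>\<^bsub>G\<^esub> e = e \<otimes>\<^bsub>G\<^esub> z" using centralizer_commute m ne by simp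
    ultimately show ?thesis
      using ne zG centralizer_closed[OF ne(2)] by (metis G.m_assoc \<iota>.hom_closed)
  qed
  have cz: "c = z \<otimes>\<^bsub>G\<^esub> d" using cG dG by (simp add: z_def G.m_assoc)
  have "conj_aut G c x = conj_aut G d x" if x: "x \<in> carrier G" for x
  proof -
    have y: "conj_aut G d x \<in> carrier G" using x dG by (simp add: conj_aut_def)
    have "conj_aut G c x = conj_aut G z (conj_aut G d x)"
      using cz G.conj_aut_mult zG dG x by simp
    also have "\<dots> = conj_aut G d x"
      using G.commute_iff_conj_fixed[OF zG y] central[OF y] y by (simp add: conj_aut_def[of G z])
    finally show ?thesis .
  qed
  then show ?thesis
    using auto_eqI G.conj_aut_auto cG dG by blast
qed

lemma order_eq: "order G = order N * order K"
  using \<pi>.order_eq_card_kernel_times_order[OF surj] kernel_eq inj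
  by (simp add: card_image order_def)

text \<open>The hypothesis on \<open>f\<close> says that the image of \<open>f\<close> has trivial center; it is phrased on \<open>G\<close>
  so that \<open>f\<close> need not be onto \<open>L\<close>. The proof climbs the lower central series of \<open>N\<close> from its
  trivial term. If \<open>f\<close> kills the commutators of \<open>x\<close> with \<open>N\<close>, then \<open>f x\<close> commutes with the image
  of \<open>N\<close>; it commutes with the image of the centralizer of \<open>N\<close> anyway, so it is central in
  the image of \<open>f\<close> and thus trivial.\<close>

lemma hom_trivial_on_nilpotent_kernel:
  assumes nil: "nilpotent_group N" and "group L" and f: "f \<in> hom G L"
    and centerless_image: "\<And>x. x \<in> carrier G \<Longrightarrow>
      (\<And>y. y \<in> carrier G \<Longrightarrow> f x \<otimes>\<^bsub>L\<^esub> f y = f y \<otimes>\<^bsub>L\<^esub> f x) \<Longrightarrow> f x = \<one>\<^bsub>L\<^esub>"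
    and n: "n \<in> carrier N"
  shows "f (\<iota> n) = \<one>\<^bsub>L\<^esub>"
proof -
  interpret L: group L by fact
  interpret f: group_hom G L f
    using f by (simp add: group_hom_def group_hom_axioms_def)
  have lower_closed: "lower_central N i \<subseteq> carrier N" for i
  proof (induction i)
    case (Suc i)
    then show ?case
      unfolding lower_central.simps by (intro N.generate_incl) auto
  qed simp
  have step: "\<forall>x\<in>lower_central N i. f (\<iota> x) = \<one>\<^bsub>L\<^esub>"
    if triv: "\<forall>x\<in>lower_central N (Suc i). f (\<iota> x) = \<one>\<^bsub>L\<^esub>" for i
  proof
    fix x assume x: "x \<in> lower_central N i"
    then have xN: "x \<in> carrier N" using lower_closed by blast
    have comm_N: "f (\<iota> x) \<otimes>\<^bsub>L\<^esub> f (\<iota> y) = f (\<iota> y) \<otimes>\<^bsub>L\<^esub> f (\<iota> x)" if y: "y \<in> carrier N" for y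
    proof -
      have "x \<otimes>\<^bsub>N\<^esub> y \<otimes>\<^bsub>N\<^esub> inv\<^bsub>N\<^esub> x \<otimes>\<^bsub>N\<^esub> inv\<^bsub>N\<^esub> y \<in> lower_central N (Suc i)"
        using x y by (auto intro!: generate.incl)
      then have "f (\<iota> (x \<otimes>\<^bsub>N\<^esub> y \<otimes>\<^bsub>N\<^esub> inv\<^bsub>N\<^esub> x \<otimes>\<^bsub>N\<^esub> inv\<^bsub>N\<^esub> y)) = \<one>\<^bsub>L\<^esub>" using triv by blast
      then have "f (\<iota> x) \<otimes>\<^bsub>L\<^esub> f (\<iota> y) \<otimes>\<^bsub>L\<^esub> inv\<^bsub>L\<^esub> (f (\<iota> y) \<otimes>\<^bsub>L\<^esub> f (\<iota> x)) = \<one>\<^bsub>L\<^esub>"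
        using xN y by (simp add: L.inv_mult_group L.m_assoc)
      then show ?thesis
        using xN y by (metis L.inv_solve_right L.l_one L.m_closed L.one_closed \<iota>.hom_closed f.hom_closed)
    qed
    show "f (\<iota> x) = \<one>\<^bsub>L\<^esub>"
    proof (rule centerless_image)
      fix g assume "g \<in> carrier G"
      then obtain m c where mc: "m \<in> carrier N" "c \<in> centralizer" "g = \<iota> m \<otimes>\<^bsub>G\<^esub> c"
        using decompose by blast
      have cG: "c \<in> carrier G" using mc centralizer_closed by blast
      have "f (\<iota> x \<otimes>\<^bsub>G\<^esub> c) = f (c \<otimes>\<^bsub>G\<^esub> \<iota> x)" using centralizer_commute mc xN by simp
      then have "f (\<iota> x) \<otimes>\<^bsub>L\<^esub> f c = f c \<otimes>\<^bsub>L\<^esub> f (\<iota> x)" using xN cG by simp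
      then show "f (\<iota> x) \<otimes>\<^bsub>L\<^esub> f g = f g \<otimes>\<^bsub>L\<^esub> f (\<iota> x)"
        using comm_N[OF mc(1)] mc xN cG by simp (metis L.m_assoc f.hom_closed \<iota>.hom_closed)
    qed (use xN in simp)
  qed
  obtain l where l: "lower_central N l = {\<one>\<^bsub>N\<^esub>}"
    using nil by (auto simp: nilpotent_group_def)
  have "\<forall>x\<in>lower_central N 0. f (\<iota> x) = \<one>\<^bsub>L\<^esub>"
  proof (rule inc_induct[of 0 l])
    show "\<forall>x\<in>lower_central N l. f (\<iota> x) = \<one>\<^bsub>L\<^esub>" using l by simp
  qed (use step in auto)
  then show ?thesis using n by simp
qed

end

section \<open>Nilpotent kernel and centerless quotient\<close>

locale nilpotent_centerless_extension = inner_extension N G K \<iota> \<pi>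
  for N :: "('n, 'x) monoid_scheme" and G :: "('g, 'y) monoid_scheme"
    and K :: "('k, 'z) monoid_scheme" and \<iota> :: "'n \<Rightarrow> 'g" and \<pi> :: "'g \<Rightarrow> 'k" +
  assumes nilpotent: "nilpotent_group N" and centerless: "centerless K"
begin

lemma epi_trivial_on_kernel:
  assumes f: "f \<in> hom G K" and f_surj: "f ` carrier G = carrier K" and n: "n \<in> carrier N"
  shows "f (\<iota> n) = \<one>\<^bsub>K\<^esub>"
proof (rule hom_trivial_on_nilpotent_kernel[OF nilpotent K.is_group f _ n])
  fix x assume "x \<in> carrier G" and "\<And>y. y \<in> carrier G \<Longrightarrow> f x \<otimes>\<^bsub>K\<^esub> f y = f y \<otimes>\<^bsub>K\<^esub> f x"
  then have "f x \<in> center K"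
    using f hom_in_carrier by (fastforce simp: center_def f_surj[symmetric])
  then show "f x = \<one>\<^bsub>K\<^esub>" using centerless by (simp add: centerless_def)
qed

text \<open>For an automorphism \<open>\<alpha>\<close>, the composition \<open>\<pi> \<circ> \<alpha>\<close> is again a surjection onto the centerless
  group \<open>K\<close>, so it kills \<open>N\<close>.\<close>

lemma kernel_characteristic:
  assumes \<alpha>: "\<alpha> \<in> auto G" and x: "x \<in> kernel G K \<pi>"
  shows "\<alpha> x \<in> kernel G K \<pi>"
proof -
  obtain n where n: "n \<in> carrier N" "x = \<iota> n" using x kernel_eq by auto
  have "(\<pi> \<circ> \<alpha>) (\<iota> n) = \<one>\<^bsub>K\<^esub>"
    by (rule epi_trivial_on_kernel[OF hom_compose[OF auto_hom[OF \<alpha>] \<pi>.homh] _ n(1)])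
      (simp only: image_comp[symmetric] auto_surj[OF \<alpha>] surj)
  then show ?thesis using n auto_closed[OF \<alpha>] by (simp add: kernel_def)
qed

lemma auto_centralizer:
  assumes \<alpha>: "\<alpha> \<in> auto G" and c: "c \<in> centralizer"
  shows "\<alpha> c \<in> centralizer"
proof -
  interpret A: group "AutoGroup G" by (rule G.AutoGroup)
  define \<beta> where "\<beta> = inv\<^bsub>AutoGroup G\<^esub> \<alpha>"
  have \<beta>: "\<beta> \<in> auto G" using \<alpha> A.inv_closed by (simp add: \<beta>_def)
  have "\<alpha> \<otimes>\<^bsub>AutoGroup G\<^esub> \<beta> = \<one>\<^bsub>AutoGroup G\<^esub>" using \<alpha> by (simp add: \<beta>_def)
  then have inverse: "\<alpha> (\<beta> x) = x" if "x \<in> carrier G" for x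
    using \<alpha> \<beta> that by (simp add: mult_AutoGroup one_AutoGroup) (metis compose_eq restrict_apply')
  have "\<alpha> c \<otimes>\<^bsub>G\<^esub> \<iota> n = \<iota> n \<otimes>\<^bsub>G\<^esub> \<alpha> c" if n: "n \<in> carrier N" for n
  proof -
    have "\<beta> (\<iota> n) \<in> \<iota> ` carrier N"
      using kernel_characteristic[OF \<beta>] n kernel_eq by auto
    then obtain m where m: "m \<in> carrier N" "\<beta> (\<iota> n) = \<iota> m" by auto
    have "\<alpha> (\<iota> m) = \<iota> n" using inverse[of "\<iota> n"] m n by simp
    moreover have "\<alpha> (c \<otimes>\<^bsub>G\<^esub> \<iota> m) = \<alpha> (\<iota> m \<otimes>\<^bsub>G\<^esub> c)"
      using centralizer_commute c m by simp
    ultimately show ?thesis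
      using Group.hom_mult[OF auto_hom[OF \<alpha>]] m centralizer_closed[OF c] by simp
  qed
  then show ?thesis
    using auto_closed[OF \<alpha>] centralizer_closed[OF c] by (simp add: centralizer_def)
qed

text \<open>The composition of \<open>\<Phi>\<close> with the induced homomorphism to \<open>Aut K\<close> has centerless image. Indeed,
  the image contains all inner automorphisms of \<open>K\<close>, and if \<open>\<sigma>\<close> commutes with conjugation by
  \<open>k\<close>, then conjugation by \<open>\<sigma> k\<close> and by \<open>k\<close> agree, so that \<open>\<sigma> k = k\<close> as \<open>K\<close> is centerless.
  Hence the composition kills \<open>N\<close>.\<close>

lemma AutoGroup_hom_trivial_on_quotient:
  assumes \<Phi>: "\<Phi> \<in> hom G (AutoGroup G)" and \<Phi>_surj: "\<Phi> ` carrier G = auto G"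
    and n: "n \<in> carrier N" and x: "x \<in> carrier G"
  shows "\<pi> (\<Phi> (\<iota> n) x) = \<pi> x"
proof -
  let ?q = "quotient_aut G K \<pi>"
  have q_apply: "?q \<alpha> (\<pi> y) = \<pi> (\<alpha> y)" if "\<alpha> \<in> auto G" "y \<in> carrier G" for \<alpha> y
    by (rule \<pi>.quotient_aut_apply[OF surj]) (use kernel_characteristic that in auto)
  have q_hom: "?q \<in> hom (AutoGroup G) (AutoGroup K)"
    by (rule \<pi>.quotient_aut_hom[OF surj]) (use kernel_characteristic in auto)
  have \<Phi>_auto: "\<Phi> y \<in> auto G" if "y \<in> carrier G" for y using \<Phi>_surj that by auto
  have q_auto: "?q \<alpha> \<in> auto K" if "\<alpha> \<in> auto G" for \<alpha>
    using hom_in_carrier[OF q_hom, of \<alpha>] that by simp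
  have "(?q \<circ> \<Phi>) (\<iota> n) = \<one>\<^bsub>AutoGroup K\<^esub>"
  proof (rule hom_trivial_on_nilpotent_kernel[OF nilpotent K.AutoGroup hom_compose[OF \<Phi> q_hom] _ n])
    fix y assume y: "y \<in> carrier G"
      and comm: "\<And>z. z \<in> carrier G \<Longrightarrow>
        (?q \<circ> \<Phi>) y \<otimes>\<^bsub>AutoGroup K\<^esub> (?q \<circ> \<Phi>) z = (?q \<circ> \<Phi>) z \<otimes>\<^bsub>AutoGroup K\<^esub> (?q \<circ> \<Phi>) y"
    define \<sigma> where "\<sigma> = ?q (\<Phi> y)"
    have \<sigma>: "\<sigma> \<in> auto K" using y \<Phi>_auto q_auto by (simp add: \<sigma>_def)
    have "\<sigma> k = k" if k: "k \<in> carrier K" for k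
    proof -
      obtain g where g: "g \<in> carrier G" "k = \<pi> g" using k surj by auto
      have q_conj: "?q (conj_aut G g) = conj_aut K k"
      proof (rule auto_eqI)
        fix l assume "l \<in> carrier K"
        then obtain h where "h \<in> carrier G" "l = \<pi> h" using surj by auto
        then show "?q (conj_aut G g) l = conj_aut K k l"
          using g by (simp add: q_apply G.conj_aut_auto) (simp add: conj_aut_def)
      qed (use g k in \<open>simp_all add: q_auto G.conj_aut_auto K.conj_aut_auto\<close>)
      have "conj_aut G g \<in> \<Phi> ` carrier G" using g \<Phi>_surj G.conj_aut_auto by simp
      then obtain z where z: "z \<in> carrier G" "\<Phi> z = conj_aut G g" by auto
      have comm_k: "compose (carrier K) \<sigma> (conj_aut K k) = compose (carrier K) (conj_aut K k) \<sigma>"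
        using comm[OF z(1)] z \<sigma> q_conj K.conj_aut_auto[OF k]
        by (simp add: \<sigma>_def[symmetric] mult_AutoGroup)
      have "conj_aut K (\<sigma> k) = conj_aut K k"
      proof (rule auto_eqI)
        fix l assume "l \<in> carrier K"
        then obtain l' where l': "l' \<in> carrier K" "l = \<sigma> l'" using auto_surj[OF \<sigma>] by auto
        then have "conj_aut K (\<sigma> k) l = \<sigma> (conj_aut K k l')"
          using K.auto_conj_aut[OF \<sigma> k] by simp
        also have "\<dots> = conj_aut K k l"
          using fun_cong[OF comm_k, of l'] l' by (simp add: compose_def)
        finally show "conj_aut K (\<sigma> k) l = conj_aut K k l" .
      qed (use k auto_closed[OF \<sigma>] in \<open>simp_all add: K.conj_aut_auto\<close>)
      then show ?thesis
        using K.conj_aut_inj[OF centerless] k auto_closed[OF \<sigma> k] by (auto dest: inj_onD)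
    qed
    then have "\<sigma> = \<one>\<^bsub>AutoGroup K\<^esub>"
      using \<sigma> K.id_in_auto unfolding one_AutoGroup by (intro auto_eqI) auto
    then show "(?q \<circ> \<Phi>) y = \<one>\<^bsub>AutoGroup K\<^esub>" by (simp add: \<sigma>_def)
  qed
  then have "?q (\<Phi> (\<iota> n)) (\<pi> x) = \<pi> x" using x by (simp add: one_AutoGroup)
  then show ?thesis using q_apply[of "\<Phi> (\<iota> n)" x] \<Phi>_auto n x by simp
qed

text \<open>Conjugation by any element of the centralizer of \<open>N\<close> over \<open>k\<close>: the choice is immaterial by
  \<open>conj_aut_centralizer_cong\<close>. So \<open>K\<close>, which need not lift to a subgroup of \<open>G\<close>
  unless \<open>G\<close> is stable, still embeds in \<open>Aut G\<close>.\<close>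

definition section_conj where
  "section_conj k = conj_aut G (SOME c. c \<in> centralizer \<and> \<pi> c = k)"

lemma section_conj_eq:
  assumes "c \<in> centralizer"
  shows "section_conj (\<pi> c) = conj_aut G c"
proof -
  let ?P = "\<lambda>d. d \<in> centralizer \<and> \<pi> d = \<pi> c"
  have "?P (SOME d. ?P d)" using assms by (intro someI[of ?P]) simp
  then show ?thesis
    unfolding section_conj_def using assms conj_aut_centralizer_cong by blast
qed

lemma section_conj_hom: "section_conj \<in> hom K (AutoGroup G)"
proof (rule homI)
  fix k assume "k \<in> carrier K"
  then obtain c where c: "c \<in> centralizer" "k = \<pi> c" using \<pi>_centralizer by auto
  then show "section_conj k \<in> carrier (AutoGroup G)"
    by (simp add: section_conj_eq G.conj_aut_auto centralizer_closed)
next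
  fix k l assume "k \<in> carrier K" "l \<in> carrier K"
  then obtain c d where c: "c \<in> centralizer" "k = \<pi> c" and d: "d \<in> centralizer" "l = \<pi> d"
    using \<pi>_centralizer by (metis imageE)
  note cG = centralizer_closed[OF c(1)] and dG = centralizer_closed[OF d(1)]
  have cd: "c \<otimes>\<^bsub>G\<^esub> d \<in> centralizer"
    by (rule subgroup.m_closed[OF centralizer_subgroup c(1) d(1)])
  have "k \<otimes>\<^bsub>K\<^esub> l = \<pi> (c \<otimes>\<^bsub>G\<^esub> d)"
    using cG dG by (simp add: c d)
  then have "section_conj (k \<otimes>\<^bsub>K\<^esub> l) = conj_aut G (c \<otimes>\<^bsub>G\<^esub> d)"
    by (simp only: section_conj_eq[OF cd])
  also have "\<dots> = conj_aut G c \<otimes>\<^bsub>AutoGroup G\<^esub> conj_aut G d"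
    by (rule Group.hom_mult[OF G.conj_aut_hom cG dG])
  finally show "section_conj (k \<otimes>\<^bsub>K\<^esub> l) = section_conj k \<otimes>\<^bsub>AutoGroup G\<^esub> section_conj l"
    by (simp only: c d section_conj_eq)
qed

text \<open>Transporting conjugation by \<open>c\<close> along \<open>\<alpha>\<close> gives conjugation by \<open>\<alpha> c\<close>. Here \<open>\<alpha> c\<close> is again in
  the centralizer of \<open>N\<close> and lies over the same point of \<open>K\<close> as \<open>c\<close>, so this is the same
  automorphism.\<close>

lemma section_conj_commute:
  assumes \<alpha>: "\<alpha> \<in> auto G" and triv: "\<And>x. x \<in> carrier G \<Longrightarrow> \<pi> (\<alpha> x) = \<pi> x"
    and k: "k \<in> carrier K"
  shows "\<alpha> \<otimes>\<^bsub>AutoGroup G\<^esub> section_conj k = section_conj k \<otimes>\<^bsub>AutoGroup G\<^esub> \<alpha>"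
proof -
  obtain c where c: "c \<in> centralizer" "k = \<pi> c" using k \<pi>_centralizer by auto
  note cG = centralizer_closed[OF c(1)]
  have "conj_aut G (\<alpha> c) = conj_aut G c"
    using conj_aut_centralizer_cong auto_centralizer[OF \<alpha> c(1)] c(1) triv[OF cG] by blast
  then have "\<alpha> (conj_aut G c x) = conj_aut G c (\<alpha> x)" if "x \<in> carrier G" for x
    using G.auto_conj_aut[OF \<alpha> cG that] by simp
  then show ?thesis
    using c cG \<alpha> by (auto simp: section_conj_eq mult_AutoGroup G.conj_aut_auto compose_def)
qed

text \<open>Injectivity is read off on \<open>K\<close>: there the first factor acts trivially and the second by
  conjugation with \<open>k\<close>, so a trivial product forces \<open>k\<close> to be central, hence trivial. The
  isomorphism \<open>\<Phi>\<close> enters a second time through \<open>|Aut G| = |G| = |N| |K|\<close>, which gives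
  surjectivity.\<close>

lemma kernel_times_section_iso:
  assumes fin: "finite (carrier G)" and \<Phi>: "\<Phi> \<in> iso G (AutoGroup G)"
  shows "(\<lambda>(n, k). \<Phi> (\<iota> n) \<otimes>\<^bsub>AutoGroup G\<^esub> section_conj k) \<in> iso (N \<times>\<times> K) (AutoGroup G)"
proof -
  have \<Phi>_hom: "\<Phi> \<in> hom G (AutoGroup G)" and \<Phi>_surj: "\<Phi> ` carrier G = auto G"
    and \<Phi>_inj: "inj_on \<Phi> (carrier G)"
    using \<Phi> by (simp_all add: iso_def bij_betw_def)
  interpret \<Phi>: group_hom G "AutoGroup G" \<Phi>
    using \<Phi>_hom G.is_group G.AutoGroup by (simp add: group_hom_def group_hom_axioms_def)
  interpret \<psi>: group_hom K "AutoGroup G" section_conj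
    using section_conj_hom K.is_group G.AutoGroup by (simp add: group_hom_def group_hom_axioms_def)
  have \<Phi>_auto: "\<Phi> (\<iota> n) \<in> auto G" if "n \<in> carrier N" for n using \<Phi>_surj that by auto
  note trivial = AutoGroup_hom_trivial_on_quotient[OF \<Phi>_hom \<Phi>_surj]
  have card_Aut: "card (auto G) = card (carrier G)"
    using \<Phi>_surj \<Phi>_inj card_image by metis
  have "(\<lambda>(n, k). (\<Phi> \<circ> \<iota>) n \<otimes>\<^bsub>AutoGroup G\<^esub> section_conj k) \<in> iso (N \<times>\<times> K) (AutoGroup G)"
  proof (rule commuting_homs_DirProd_iso[OF N.is_group K.is_group G.AutoGroup
        hom_compose[OF \<iota>.homh \<Phi>_hom] section_conj_hom])
    fix n k assume nk: "n \<in> carrier N" "k \<in> carrier K"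
    show "(\<Phi> \<circ> \<iota>) n \<otimes>\<^bsub>AutoGroup G\<^esub> section_conj k = section_conj k \<otimes>\<^bsub>AutoGroup G\<^esub> (\<Phi> \<circ> \<iota>) n"
      using section_conj_commute[OF \<Phi>_auto trivial] nk by simp
    assume one: "(\<Phi> \<circ> \<iota>) n \<otimes>\<^bsub>AutoGroup G\<^esub> section_conj k = \<one>\<^bsub>AutoGroup G\<^esub>"
    obtain c where c: "c \<in> centralizer" "k = \<pi> c" using nk \<pi>_centralizer by auto
    note cG = centralizer_closed[OF c(1)]
    have "k = \<one>\<^bsub>K\<^esub>"
    proof (rule K.centerless_conj_fixed[OF centerless nk(2)])
      fix l assume "l \<in> carrier K"
      then obtain x where x: "x \<in> carrier G" "l = \<pi> x" using surj by auto
      have y: "conj_aut G c x \<in> carrier G" using x cG by (simp add: conj_aut_def)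
      have "compose (carrier G) (\<Phi> (\<iota> n)) (conj_aut G c) = (\<lambda>x \<in> carrier G. x)"
        using one nk c cG \<Phi>_auto
        by (simp add: section_conj_eq mult_AutoGroup one_AutoGroup G.conj_aut_auto)
      from fun_cong[OF this, of x] have "\<Phi> (\<iota> n) (conj_aut G c x) = x"
        using x by (simp add: compose_def)
      then have "\<pi> (conj_aut G c x) = \<pi> x" using trivial[OF nk(1) y] by simp
      then show "conj_aut K k l = l" using x c cG by (simp add: conj_aut_def)
    qed
    moreover from this have "\<Phi> (\<iota> n) = \<one>\<^bsub>AutoGroup G\<^esub>" using one nk \<Phi>_auto by simp
    then have "\<iota> n = \<one>\<^bsub>G\<^esub>" using \<Phi>_inj nk \<Phi>.inj_on_one_iff by simp
    then have "n = \<one>\<^bsub>N\<^esub>" using inj nk \<iota>.inj_on_one_iff by simp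
    ultimately show "n = \<one>\<^bsub>N\<^esub> \<and> k = \<one>\<^bsub>K\<^esub>" by simp
  next
    show "finite (carrier (AutoGroup G))"
      using fin \<Phi>_surj by (metis carrier_AutoGroup finite_imageI)
    show "order (AutoGroup G) = order N * order K"
      using card_Aut order_eq by (simp add: order_def)
  qed
  then show ?thesis by simp
qed

text \<open>By the isomorphism just proved, \<open>\<alpha>\<close> is the product of an automorphism that is trivial on \<open>K\<close>
  and a conjugation.\<close>

lemma auto_inner_on_quotient:
  assumes fin: "finite (carrier G)" and \<Phi>: "\<Phi> \<in> iso G (AutoGroup G)" and \<alpha>: "\<alpha> \<in> auto G"
  obtains h where "h \<in> carrier G" "\<And>x. x \<in> carrier G \<Longrightarrow> \<pi> (\<alpha> x) = \<pi> (conj_aut G h x)"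
proof -
  have \<Phi>_hom: "\<Phi> \<in> hom G (AutoGroup G)" and \<Phi>_surj: "\<Phi> ` carrier G = auto G"
    using \<Phi> by (simp_all add: iso_def bij_betw_def)
  have "\<alpha> \<in> (\<lambda>(n, k). \<Phi> (\<iota> n) \<otimes>\<^bsub>AutoGroup G\<^esub> section_conj k) ` carrier (N \<times>\<times> K)"
    using kernel_times_section_iso[OF fin \<Phi>] \<alpha> by (simp add: iso_def bij_betw_def)
  then obtain n k where nk: "n \<in> carrier N" "k \<in> carrier K"
    "\<alpha> = \<Phi> (\<iota> n) \<otimes>\<^bsub>AutoGroup G\<^esub> section_conj k" by auto
  obtain c where c: "c \<in> centralizer" "k = \<pi> c" using nk \<pi>_centralizer by auto
  note cG = centralizer_closed[OF c(1)]
  have \<Phi>_auto: "\<Phi> (\<iota> n) \<in> auto G" using \<Phi>_surj nk by auto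
  show ?thesis
  proof (rule that[OF cG])
    fix x assume x: "x \<in> carrier G"
    have "conj_aut G c x \<in> carrier G" using x cG by (simp add: conj_aut_def)
    then show "\<pi> (\<alpha> x) = \<pi> (conj_aut G c x)"
      using AutoGroup_hom_trivial_on_quotient[OF \<Phi>_hom \<Phi>_surj nk(1)] nk c cG \<Phi>_auto x
      by (simp add: section_conj_eq mult_AutoGroup G.conj_aut_auto compose_def)
  qed
qed

text \<open>The isomorphism \<open>\<theta>\<close> need not be compatible with \<open>\<pi>\<close>. Its second component \<open>p\<close> is
  nevertheless constant on the fibres of \<open>\<pi>\<close>, because it is onto the centerless group \<open>K\<close> and
  thus kills \<open>N\<close>; this transfers statements about \<open>\<pi>\<close> to \<open>p\<close>. An automorphism \<open>\<sigma>\<close> of \<open>K\<close>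
  lifts along \<open>p\<close> to \<open>\<theta>\<inverse> \<circ> (id \<times> \<sigma>) \<circ> \<theta>\<close>, and each automorphism of \<open>G\<close> is a conjugation
  modulo \<open>N\<close>.\<close>

lemma complete_quotient:
  assumes fin: "finite (carrier G)" and \<Phi>: "\<Phi> \<in> iso G (AutoGroup G)"
    and \<theta>: "\<theta> \<in> iso G (N \<times>\<times> K)"
  shows "complete_group K"
proof (rule K.complete_groupI[OF centerless], rule subsetI)
  fix \<sigma> assume \<sigma>: "\<sigma> \<in> auto K"
  define p where "p = snd \<circ> \<theta>"
  have p_hom: "p \<in> hom G K"
  proof -
    have "snd \<in> hom (N \<times>\<times> K) K" by (rule homI) (auto simp: mult_DirProd')
    then show ?thesis using \<theta> unfolding p_def by (intro hom_compose) (auto simp: iso_def)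
  qed
  interpret p: group_hom G K p
    using p_hom by (simp add: group_hom_def group_hom_axioms_def)
  have \<theta>_surj: "\<theta> ` carrier G = carrier N \<times> carrier K"
    using \<theta> by (simp add: iso_def bij_betw_def)
  then have p_surj: "p ` carrier G = carrier K"
    unfolding p_def image_comp[symmetric] using N.one_closed by force
  have p_cong: "p x = p y" if "x \<in> carrier G" "y \<in> carrier G" "\<pi> x = \<pi> y" for x y
  proof -
    have "x \<otimes>\<^bsub>G\<^esub> inv\<^bsub>G\<^esub> y \<in> \<iota> ` carrier N"
      using that \<pi>.eq_iff_diff_in_kernel kernel_eq by blast
    then have "x \<otimes>\<^bsub>G\<^esub> inv\<^bsub>G\<^esub> y \<in> kernel G K p"
      using epi_trivial_on_kernel[OF p_hom p_surj] by (auto simp: kernel_def)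
    then show ?thesis using that p.eq_iff_diff_in_kernel by blast
  qed
  \<comment> \<open>The lift of \<open>\<sigma>\<close> to \<open>G\<close>; the restriction makes it extensional, as \<open>auto G\<close> requires.\<close>
  define s where "s = (\<lambda>(n :: 'n, k). (n, \<sigma> k))"
  have \<sigma>_iso: "\<sigma> \<in> iso K K" using \<sigma> auto_iff_iso by blast
  have s_iso: "s \<in> iso (N \<times>\<times> K) (N \<times>\<times> K)"
    using N.DirProd_iso_set_trans[OF iso_set_refl \<sigma>_iso] by (simp add: s_def)
  define t where "t = inv_into (carrier G) \<theta> \<circ> (s \<circ> \<theta>)"
  have t_iso: "t \<in> iso G G"
    using iso_set_trans[OF iso_set_trans[OF \<theta> s_iso] G.iso_set_sym[OF \<theta>]] by (simp add: t_def)
  define \<alpha> where "\<alpha> = restrict t (carrier G)"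
  have \<alpha>: "\<alpha> \<in> auto G"
    unfolding \<alpha>_def by (rule restrict_iso_auto[OF t_iso G.is_group])
  have p_\<alpha>: "p (\<alpha> x) = \<sigma> (p x)" if x: "x \<in> carrier G" for x
  proof -
    have "s (\<theta> x) \<in> \<theta> ` carrier G"
    proof -
      have "\<theta> x \<in> carrier N \<times> carrier K" using x \<theta>_surj by blast
      then show ?thesis unfolding \<theta>_surj by (auto simp: s_def auto_closed[OF \<sigma>])
    qed
    then have "\<theta> (\<alpha> x) = s (\<theta> x)"
      using x by (simp add: \<alpha>_def t_def f_inv_into_f)
    then show ?thesis by (simp add: p_def s_def split_beta)
  qed
  obtain h where h: "h \<in> carrier G" "\<And>x. x \<in> carrier G \<Longrightarrow> \<pi> (\<alpha> x) = \<pi> (conj_aut G h x)"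
    using auto_inner_on_quotient[OF fin \<Phi> \<alpha>] by blast
  have "\<sigma> = conj_aut K (p h)"
  proof (rule auto_eqI[OF \<sigma> K.conj_aut_auto])
    fix k assume "k \<in> carrier K"
    then obtain x where x: "x \<in> carrier G" "k = p x" using p_surj by auto
    have y: "conj_aut G h x \<in> carrier G" using x h by (simp add: conj_aut_def)
    have "\<sigma> k = p (\<alpha> x)" using p_\<alpha> x by simp
    also have "\<dots> = p (conj_aut G h x)"
      using p_cong[OF auto_closed[OF \<alpha> x(1)] y] h x by blast
    also have "\<dots> = conj_aut K (p h) k" using x h by (simp add: conj_aut_def)
    finally show "\<sigma> k = conj_aut K (p h) k" .
  qed (use h in simp)
  then show "\<sigma> \<in> Inn K" using h by (simp add: Inn_def)
qed

end

theorem lemma3p2: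
  fixes N :: "('n, 'x) monoid_scheme"
    and G :: "('g, 'y) monoid_scheme"
    and K :: "('k, 'z) monoid_scheme"
    and \<iota> :: "'n \<Rightarrow> 'g" and \<pi> :: "'g \<Rightarrow> 'k"
  assumes "finite (carrier N)" and "finite (carrier G)" and "finite (carrier K)"
    and "group_extension N G K \<iota> \<pi>"
    and "trivial_outer_action N G \<iota>"
    and "nilpotent_group N"
    and "centerless K"
    and "stable_group G"
  shows "G \<cong> N \<times>\<times> K \<and> complete_group K"
proof -
  interpret nilpotent_centerless_extension N G K \<iota> \<pi>
    using assms(4-7) by unfold_locales
  obtain \<Phi> where \<Phi>: "\<Phi> \<in> iso G (AutoGroup G)"
    using assms(8) by (auto simp: stable_group_def is_iso_def)
  have "N \<times>\<times> K \<cong> AutoGroup G"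
    using kernel_times_section_iso[OF assms(2) \<Phi>] by (rule is_isoI)
  then have "AutoGroup G \<cong> N \<times>\<times> K"
    using group.iso_sym[OF DirProd_group[OF N.is_group K.is_group]] by blast
  then have iso: "G \<cong> N \<times>\<times> K"
    using assms(8) iso_trans by (auto simp: stable_group_def)
  then obtain \<theta> where "\<theta> \<in> iso G (N \<times>\<times> K)" by (auto simp: is_iso_def)
  then show ?thesis using complete_quotient[OF assms(2) \<Phi>] iso by blast
qed

end
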